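(* Let $H \cong Z_n$ be a finite cyclic group of order $n \geq 2$, let $m > 1$ be an integer, and let $k = \gcd(m,n)$. Assume that $m\text{-}G(H)$ is connected, i.e., every prime factor of $n$ is a prime factor of $m$. Then the graph $m\text{-}G(H)$ is graph-isomorphic to the graph $k\text{-}G(H)$.
   Context: $Z_n$ is the additive cyclic group of integers modulo $n$. For a finite abelian group $H$ (written additively) and an integer $r>1$, the graph $r\text{-}G(H)$ is the simple undirected graph with vertex set $H$ in which two distinct vertices $a,b$ are adjacent if and only if $ra=b$ or $rb=a$. *)

theory Defs
  imports
    "HOL-Algebra.Elementary_Groups"
    "Graph_Theory.Digraph_Component"
    "Graph_Theory.Digraph_Isomorphism"
begin

text \<open>
  As in the library, an undirected simple graph is a symmetric loop-free digraph
  without parallel arcs: each edge between \<open>a\<close> and \<open>b\<close> is the pair of arcs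
  \<open>(a, b)\<close>, \<open>(b, a)\<close>. Groups are written multiplicatively here, so the multiple
  \<open>r a\<close> of the additive notation is the power \<open>a [^]\<^bsub>H\<^esub> r\<close>.
\<close>

definition multiple_graph :: "nat \<Rightarrow> ('a, 'b) monoid_scheme \<Rightarrow> 'a pair_pre_digraph" where
  "multiple_graph r H =
     \<lparr> pverts = carrier H,
       parcs = {(a, b). a \<in> carrier H \<and> b \<in> carrier H \<and> a \<noteq> b \<and>
                        (a [^]\<^bsub>H\<^esub> r = b \<or> b [^]\<^bsub>H\<^esub> r = a)} \<rparr>"

lemma pair_graph_multiple_graph:
  assumes "finite (carrier H)"
  shows "pair_graph (multiple_graph r H)"
proof
  show "finite (parcs (multiple_graph r H))"
    by (rule finite_subset[of _ "carrier H \<times> carrier H"])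
       (auto simp: multiple_graph_def assms)
qed (auto simp: multiple_graph_def assms symmetric_def sym_def)

end

theory Submission
  imports
    Defs
    "HOL-Algebra.Multiplicative_Group"
    "HOL-Number_Theory.Cong"
begin

text \<open>
  Both graphs are the underlying graphs of functional graphs, those of \<open>x \<mapsto> x\<^sup>m\<close> and of
  \<open>x \<mapsto> x\<^sup>k\<close>, so a bijection \<open>\<phi>\<close> of the group with \<open>\<phi> (x\<^sup>m) = (\<phi> x)\<^sup>k\<close> is an isomorphism
  between them (\<open>digraph_iso_multiple_graphI\<close>).

  On a group of exponent \<open>n\<close> only the residue of \<open>m\<close> modulo \<open>n\<close> matters, and that residue is
  \<open>k u\<close> for some \<open>u\<close> coprime to \<open>n\<close> (\<open>gcd_times_coprime_cong\<close>). The two maps thus differ by the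
  permutation \<open>x \<mapsto> x\<^sup>u\<close>. To absorb this factor, let the depth of \<open>x\<close> be the number of times
  the \<open>k\<close>-th power has to be taken until \<open>x\<close> becomes the identity, and put
  \<open>\<phi> x = x ^ (u ^ depth x)\<close>. One application of either map lowers the depth of a non-identity
  element by one, and the factor \<open>u\<close> lost in the exponent of \<open>\<phi>\<close> is the one that
  distinguishes \<open>x\<^sup>m\<close> from \<open>x\<^sup>k\<close>. Powers with exponent coprime to \<open>n\<close> preserve the depth, so \<open>\<phi>\<close>
  can be inverted on each level separately.

  Connectedness makes every depth finite: if iterating \<open>x \<mapsto> x\<^sup>m\<close> takes a vertex to the
  identity, then it does so for all neighbours as well, and every vertex is joined to the
  identity. The iterates of \<open>x \<mapsto> x\<^sup>k\<close> differ from these by powers coprime to \<open>n\<close>, so they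
  reach the identity too.
\<close>

section \<open>Residues as multiples of a greatest common divisor by a unit\<close>

text \<open>
  Write \<open>m = k m'\<close> and \<open>n = k n'\<close>. The cofactor \<open>m'\<close> is coprime to \<open>n'\<close> but may share
  primes with \<open>n\<close>; add to it \<open>n'\<close> times the product of the primes of \<open>n\<close> that do
  not divide \<open>m'\<close>. Then each prime of \<open>n\<close> divides exactly one of the two summands.
\<close>

lemma gcd_times_coprime_cong:
  fixes m n :: nat
  assumes "n > 0"
  obtains u where "coprime u n" and "[m = gcd m n * u] (mod n)"
proof -
  obtain m' n' where m: "m = gcd m n * m'" and n: "n = gcd m n * n'" and cop: "coprime m' n'"
    using gcd_coprime_exists[of m n] assms by (auto simp: mult.commute)
  define P where "P = {p. prime p \<and> p dvd n \<and> \<not> p dvd m'}"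
  define u where "u = m' + n' * \<Prod>P"
  have "finite P"
    using assms by (auto simp: P_def intro: finite_subset[OF _ finite_divisors_nat])
  have "\<not> p dvd u" if p: "prime p" "p dvd n" for p
  proof (cases "p dvd m'")
    case True
    have "\<not> p dvd n'"
      using True cop p(1) not_prime_unit coprime_common_divisor by blast
    moreover have "\<not> p dvd \<Prod>P"
    proof
      assume "p dvd \<Prod>P"
      then obtain q where "q \<in> P" "p dvd q"
        using prime_dvd_prod_iff[OF \<open>finite P\<close> p(1), of "\<lambda>x. x"] by auto
      then show False
        using True p(1) primes_dvd_imp_eq[of p q] by (auto simp: P_def)
    qed
    ultimately show ?thesis
      using True p(1) by (simp add: u_def dvd_add_right_iff prime_dvd_mult_iff)
  next
    case False
    then have "p dvd \<Prod>P"
      using p \<open>finite P\<close> dvd_prodI[of P p "\<lambda>x. x"] by (simp add: P_def)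
    then show ?thesis
      using False by (simp add: u_def dvd_add_left_iff)
  qed
  then have "coprime u n"
    using prime_factor_nat[of "gcd u n"] by (auto simp: coprime_iff_gcd_eq_1)
  moreover have "gcd m n * u = m + n * \<Prod>P"
    using m n by (simp add: u_def distrib_left flip: mult.assoc)
  then have "[m = gcd m n * u] (mod n)"
    by (simp add: cong_def)
  ultimately show thesis
    by (rule that)
qed

section \<open>Depth with respect to a power map\<close>

definition (in group) power_depth :: "nat \<Rightarrow> 'a \<Rightarrow> nat" where
  "power_depth k x = (LEAST j. x [^] (k ^ j) = \<one>)"

lemma (in group) Suc_power_depth_pow:
  assumes "x \<in> carrier G" and "x [^] (k ^ j) = \<one>" and "x \<noteq> \<one>"
  shows "power_depth k x = Suc (power_depth k (x [^] k))"
proof -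
  have "\<not> x [^] (k ^ 0) = \<one>"
    using assms(1,3) by simp
  from Least_Suc[of "\<lambda>j. x [^] (k ^ j) = \<one>", OF assms(2) this] show ?thesis
    using assms(1) by (simp add: power_depth_def nat_pow_pow)
qed

section \<open>Groups whose exponent divides a given number\<close>

locale exponent_dvd_group = group +
  fixes n :: nat
  assumes pow_exponent: "x \<in> carrier G \<Longrightarrow> x [^] n = \<one>"
begin

lemma pow_cong:
  assumes "[a = b] (mod n)" and x: "x \<in> carrier G"
  shows "x [^] a = x [^] b"
proof -
  have "x [^] c = x [^] (c mod n)" for c
  proof -
    have "x [^] c = x [^] (n * (c div n) + c mod n)"
      by simp
    also have "\<dots> = (x [^] n) [^] (c div n) \<otimes> x [^] (c mod n)"
      using x by (simp only: nat_pow_mult nat_pow_pow)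
    finally show ?thesis
      using x by (simp add: pow_exponent)
  qed
  then show ?thesis
    using assms(1) by (metis cong_def)
qed

lemma pow_pow_inverse:
  assumes "[a * b = 1] (mod n)" and "x \<in> carrier G"
  shows "(x [^] a) [^] b = x"
  using pow_cong[OF assms] assms(2) by (simp add: nat_pow_pow)

lemma pow_coprime_inject:
  assumes "coprime a n" and "x \<in> carrier G" "y \<in> carrier G"
  shows "x [^] a = y [^] a \<longleftrightarrow> x = y"
proof -
  obtain b where "[a * b = 1] (mod n)"
    using cong_solve_coprime_nat[OF assms(1)] by auto
  then show ?thesis
    using pow_pow_inverse assms(2,3) by metis
qed

lemma power_depth_pow_coprime:
  assumes "coprime a n" and x: "x \<in> carrier G"
  shows "power_depth k (x [^] a) = power_depth k x"
proof -
  have "(x [^] a) [^] (k ^ j) = \<one> \<longleftrightarrow> x [^] (k ^ j) = \<one>" for j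
    using pow_coprime_inject[OF assms(1), of "x [^] (k ^ j)" \<one>] x
    by (simp add: nat_pow_pow mult.commute)
  then show ?thesis
    by (simp add: power_depth_def)
qed

definition depth_twist :: "nat \<Rightarrow> nat \<Rightarrow> 'a \<Rightarrow> 'a" where
  "depth_twist k u x = x [^] (u ^ power_depth k x)"

text \<open>
  Since \<open>depth_twist\<close> preserves the depth and is a single power map with exponent coprime to \<open>n\<close>
  on each level, it is a bijection on each level.
  The elements that no iterate of \<open>x \<mapsto> x\<^sup>k\<close> takes to the identity do no harm: they all share
  the unspecified value of \<open>power_depth\<close>, and powers with exponent coprime to \<open>n\<close> permute them.
\<close>

lemma bij_betw_depth_twist:
  assumes u: "coprime u n"
  shows "bij_betw (depth_twist k u) (carrier G) (carrier G)"
proof (rule bij_betw_imageI)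
  show "inj_on (depth_twist k u) (carrier G)"
  proof (rule inj_onI)
    fix x y
    assume xy: "x \<in> carrier G" "y \<in> carrier G" and eq: "depth_twist k u x = depth_twist k u y"
    from eq have "power_depth k x = power_depth k y"
      unfolding depth_twist_def using power_depth_pow_coprime xy u by (metis coprime_power_left_iff)
    with eq show "x = y"
      using pow_coprime_inject[of "u ^ power_depth k y" x y] xy u by (simp add: depth_twist_def)
  qed
  have "y \<in> depth_twist k u ` carrier G" if y: "y \<in> carrier G" for y
  proof -
    obtain b where b: "[u ^ power_depth k y * b = 1] (mod n)"
      using cong_solve_coprime_nat[of "u ^ power_depth k y" n] u by auto
    then have "[b * u ^ power_depth k y = 1] (mod n)"
      by (simp add: mult.commute)
    moreover from this have "coprime b n"
      using coprime_iff_invertible_nat by auto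
    ultimately have "depth_twist k u (y [^] b) = y"
      using y by (simp add: depth_twist_def power_depth_pow_coprime pow_pow_inverse)
    then show ?thesis
      using y by (metis imageI nat_pow_closed)
  qed
  then show "depth_twist k u ` carrier G = carrier G"
    by (auto simp: depth_twist_def)
qed

text \<open>
  For \<open>x\<close> of depth \<open>d + 1\<close>, the depth of \<open>x\<^sup>m = (x\<^sup>k)\<^sup>u\<close> is \<open>d\<close>, so both sides are the power of
  \<open>x\<close> with exponent \<open>k u\<^bsup>d + 1\<^esup>\<close>.
\<close>

lemma depth_twist_pow:
  assumes u: "coprime u n" and m: "[m = k * u] (mod n)"
    and x: "x \<in> carrier G" and j: "x [^] (k ^ j) = \<one>"
  shows "depth_twist k u (x [^] m) = depth_twist k u x [^] k"
proof (cases "x = \<one>")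
  case True
  then show ?thesis
    by (simp add: depth_twist_def)
next
  case False
  have xm: "x [^] m = (x [^] k) [^] u"
    using pow_cong[OF m x] x by (simp add: nat_pow_pow)
  have "power_depth k x = Suc (power_depth k (x [^] m))"
    using Suc_power_depth_pow[OF x j False] power_depth_pow_coprime[OF u] x xm by simp
  then show ?thesis
    using x by (simp add: depth_twist_def nat_pow_pow xm mult_ac)
qed

lemma pow_power_eq_one_of_cong:
  assumes u: "coprime u n" and m: "[m = k * u] (mod n)"
    and x: "x \<in> carrier G" and j: "x [^] (m ^ j) = \<one>"
  shows "x [^] (k ^ j) = \<one>"
proof -
  have "[m ^ j = k ^ j * u ^ j] (mod n)"
    using cong_pow[OF m, of j] by (simp add: power_mult_distrib)
  then have "(x [^] (k ^ j)) [^] (u ^ j) = \<one>"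
    using pow_cong[of "m ^ j" "k ^ j * u ^ j" x] x j by (simp add: nat_pow_pow)
  then show ?thesis
    using pow_coprime_inject[of "u ^ j" "x [^] (k ^ j)" \<one>] u x by simp
qed

end

section \<open>Multiple graphs\<close>

lemma (in group) connected_multiple_graph_imp_torsion:
  assumes conn: "connected (with_proj (multiple_graph m G))" and x: "x \<in> carrier G"
  shows "\<exists>j. x [^] (m ^ j) = \<one>"
proof -
  have "(\<one>, x) \<in> rtrancl_on (carrier G) ((parcs (multiple_graph m G))\<^sup>s)"
    using conn x by (auto simp: connected_conv multiple_graph_def)
  then show ?thesis
  proof (induction rule: rtrancl_on_induct)
    case base
    show ?case
      by simp
  next
    case (step y z)
    from step.IH obtain j where j: "y [^] (m ^ j) = \<one>"
      by blast
    from step.hyps have "y [^] m = z \<or> z [^] m = y"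
      by (auto simp: symcl_def multiple_graph_def)
    then show ?case
    proof
      assume "y [^] m = z"
      then have "z [^] (m ^ j) = (y [^] (m ^ j)) [^] m"
        using step.hyps by (auto simp: nat_pow_pow mult.commute)
      then show ?thesis
        using j by auto
    next
      assume "z [^] m = y"
      then have "z [^] (m ^ Suc j) = \<one>"
        using j step.hyps by (auto simp: nat_pow_pow)
      then show ?thesis ..
    qed
  qed
qed

lemma digraph_iso_multiple_graphI:
  fixes G :: "('a, 'c) monoid_scheme" and H :: "('b, 'd) monoid_scheme"
  assumes "monoid G"
    and bij: "bij_betw f (carrier G) (carrier H)"
    and conj: "\<And>x. x \<in> carrier G \<Longrightarrow> f (x [^]\<^bsub>G\<^esub> r) = f x [^]\<^bsub>H\<^esub> s"
  shows "digraph_iso (with_proj (multiple_graph r G)) (with_proj (multiple_graph s H))"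
proof -
  interpret monoid G by fact
  let ?G = "multiple_graph r G" and ?H = "multiple_graph s H"
  define h where
    "h = \<lparr>iso_verts = f, iso_arcs = map_prod f f, iso_head = snd, iso_tail = fst\<rparr>"
  have inj: "inj_on f (carrier G)" and img: "f ` carrier G = carrier H"
    using bij by (auto simp: bij_betw_def)
  have step_iff: "f x [^]\<^bsub>H\<^esub> s = f y \<longleftrightarrow> x [^]\<^bsub>G\<^esub> r = y"
    if "x \<in> carrier G" "y \<in> carrier G" for x y
    using that inj by (simp add: conj[symmetric] inj_on_eq_iff)
  have arc_iff: "(f x, f y) \<in> parcs ?H \<longleftrightarrow> (x, y) \<in> parcs ?G"
    if "x \<in> carrier G" "y \<in> carrier G" for x y
    using that img inj by (auto simp: multiple_graph_def step_iff inj_on_eq_iff)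
  have "wf_digraph (with_proj ?G)"
    by unfold_locales (auto simp: multiple_graph_def)
  moreover have "inj_on (map_prod f f) (parcs ?G)"
    by (rule inj_on_subset[OF map_prod_inj_on[OF inj inj]]) (auto simp: multiple_graph_def)
  ultimately have "pre_digraph.digraph_isomorphism (with_proj ?G) h"
    using inj by (simp add: pre_digraph.digraph_isomorphism_def h_def multiple_graph_def)
  moreover have "parcs ?H = map_prod f f ` parcs ?G"
  proof
    show "map_prod f f ` parcs ?G \<subseteq> parcs ?H"
      using arc_iff by (auto simp: multiple_graph_def)
    show "parcs ?H \<subseteq> map_prod f f ` parcs ?G"
    proof
      fix e
      assume e: "e \<in> parcs ?H"
      then have "e \<in> f ` carrier G \<times> f ` carrier G"
        unfolding img by (auto simp: multiple_graph_def)
      then obtain x y where "e = (f x, f y)" "x \<in> carrier G" "y \<in> carrier G"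
        by auto
      then show "e \<in> map_prod f f ` parcs ?G"
        using e arc_iff by (auto intro: rev_image_eqI)
    qed
  qed
  then have "with_proj ?H = app_iso h (with_proj ?G)"
    using img by (simp add: app_iso_def h_def with_proj_def multiple_graph_def)
  ultimately show ?thesis
    unfolding digraph_iso_def by blast
qed

theorem theorem3p6:
  fixes H :: "('a, 'b) monoid_scheme" and n m k :: nat
  assumes "comm_group H"
    and "H \<cong> integer_mod_group n"
    and "n \<ge> 2"
    and "m > 1"
    and "k = gcd m n"
    and "connected (with_proj (multiple_graph m H))"
  shows "digraph_iso (with_proj (multiple_graph m H)) (with_proj (multiple_graph k H))"
proof -
  interpret comm_group H by fact
  have "order H = n"
    using iso_same_card[OF assms(2)] assms(3) by (simp add: order_def carrier_integer_mod_group)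
  then interpret exponent_dvd_group H n
    by unfold_locales (use pow_order_eq_1 in auto)
  obtain u where u: "coprime u n" and m: "[m = k * u] (mod n)"
    using gcd_times_coprime_cong[of n m] assms(3,5) by auto
  have "depth_twist k u (x [^]\<^bsub>H\<^esub> m) = depth_twist k u x [^]\<^bsub>H\<^esub> k"
    if x: "x \<in> carrier H" for x
    using connected_multiple_graph_imp_torsion[OF assms(6) x]
      pow_power_eq_one_of_cong[OF u m x] depth_twist_pow[OF u m x] by blast
  then show ?thesis
    by (rule digraph_iso_multiple_graphI[OF is_monoid bij_betw_depth_twist[OF u]])
qed

end
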